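(* Let $\Pi$ be a graph property that is closed under adding degree-one vertices. There is a function $f\colon\mathbb N\to\mathbb N$ such that, for each fixed $m\in\mathbb N$, there is an algorithm that decides whether a given hypergraph $\mathcal H$ with $m$ hyperedges has a support satisfying $\Pi$ in time $f(m)\cdot\mathrm{poly}(|\mathcal H|)$.
   Context: Hypergraphs have no hyperedges of size at most one and no repeated hyperedges. A support for a hypergraph $\mathcal H=(\mathcal V,\mathcal E)$ is a graph on vertex set $\mathcal V$ such that each hyperedge induces a connected subgraph. A graph property $\Pi$ is closed under adding degree-one vertices if whenever $G$ satisfies $\Pi$, so does any graph obtained from $G$ by adding a new vertex adjacent to exactly one vertex of $G$. *)

theory Defs
  imports "Graph_Theory.Graph_Theory" "HOL-Computational_Algebra.Polynomial"
begin

section \<open>Graph properties\<close>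

text \<open>Finite simple undirected graphs are the symmetric loop-free \<^const>\<open>pair_graph\<close>s: an edge
  between \<open>u\<close> and \<open>v\<close> is the pair of arcs \<open>(u, v)\<close> and \<open>(v, u)\<close>.  Vertices are natural numbers; as
  properties are isomorphism invariant, this covers all finite graphs.\<close>

type_synonym ngraph = "nat pair_pre_digraph"

definition graph_property :: "(ngraph \<Rightarrow> bool) \<Rightarrow> bool" where
  "graph_property P \<longleftrightarrow>
     (\<forall>G G'. pair_graph G \<and> pair_graph G' \<and> digraph_iso (with_proj G) (with_proj G') \<and> P G
        \<longrightarrow> P G')"

definition add_leaf :: "ngraph \<Rightarrow> nat \<Rightarrow> nat \<Rightarrow> ngraph" where
  "add_leaf G u v =
     \<lparr> pverts = insert v (pverts G), parcs = parcs G \<union> {(u, v), (v, u)} \<rparr>"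

definition closed_under_adding_leaves :: "(ngraph \<Rightarrow> bool) \<Rightarrow> bool" where
  "closed_under_adding_leaves P \<longleftrightarrow>
     (\<forall>G u v. pair_graph G \<and> P G \<and> u \<in> pverts G \<and> v \<notin> pverts G \<longrightarrow> P (add_leaf G u v))"


section \<open>Hypergraphs and supports\<close>

record hypergraph =
  hverts :: "nat set"
  hedges :: "nat set set"

definition wf_hypergraph :: "hypergraph \<Rightarrow> bool" where
  "wf_hypergraph H \<longleftrightarrow>
     finite (hverts H) \<and> (\<forall>e\<in>hedges H. e \<subseteq> hverts H \<and> 2 \<le> card e)"

definition support :: "hypergraph \<Rightarrow> ngraph \<Rightarrow> bool" where
  "support H G \<longleftrightarrow>
     pair_graph G \<and> pverts G = hverts H \<and>
     (\<forall>e\<in>hedges H. Digraph_Component.connected (with_proj G \<restriction> e))"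

definition has_support_satisfying :: "(ngraph \<Rightarrow> bool) \<Rightarrow> hypergraph \<Rightarrow> bool" where
  "has_support_satisfying P H \<longleftrightarrow> (\<exists>G. support H G \<and> P G)"


section \<open>Deterministic multi-tape Turing machines\<close>

text \<open>Symbols and states are initial segments of the natural numbers; symbol \<open>0\<close> is the blank
  and \<open>1, \<dots>, 4\<close> form the input alphabet.  Tapes are infinite in both directions.\<close>

datatype move = Move_Left | Stay | Move_Right

primrec offset :: "move \<Rightarrow> int" where
  "offset Move_Left = -1"
| "offset Stay = 0"
| "offset Move_Right = 1"

record tm =
  n_tapes :: nat
  n_symbols :: nat
  n_states :: nat
  start_state :: nat
  accept_state :: nat
  reject_state :: nat
  transition :: "nat \<Rightarrow> nat list \<Rightarrow> nat \<times> (nat \<times> move) list"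

definition turing_machine :: "tm \<Rightarrow> bool" where
  "turing_machine M \<longleftrightarrow>
     1 \<le> n_tapes M \<and> 5 \<le> n_symbols M \<and>
     start_state M < n_states M \<and> accept_state M < n_states M \<and> reject_state M < n_states M \<and>
     accept_state M \<noteq> reject_state M \<and>
     (\<forall>q syms q' acts.
        q < n_states M \<and> length syms = n_tapes M \<and> set syms \<subseteq> {..<n_symbols M} \<and>
        transition M q syms = (q', acts) \<longrightarrow>
        q' < n_states M \<and> length acts = n_tapes M \<and> fst ` set acts \<subseteq> {..<n_symbols M})"

text \<open>A tape is its contents together with the position of its head.\<close>

type_synonym tape = "(int \<Rightarrow> nat) \<times> int"

type_synonym config = "nat \<times> tape list"

fun act :: "nat \<times> move \<Rightarrow> tape \<Rightarrow> tape" where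
  "act (s, d) (t, h) = (t(h := s), h + offset d)"

fun step :: "tm \<Rightarrow> config \<Rightarrow> config" where
  "step M (q, ts) =
     (if q = accept_state M \<or> q = reject_state M then (q, ts)
      else let (q', acts) = transition M q (map (\<lambda>(t, h). t h) ts)
           in (q', map2 act acts ts))"

definition input_tape :: "nat list \<Rightarrow> tape" where
  "input_tape w = (\<lambda>i. if 0 \<le> i \<and> i < int (length w) then w ! nat i else 0, 0)"

definition initial_config :: "tm \<Rightarrow> nat list \<Rightarrow> config" where
  "initial_config M w =
     (start_state M, input_tape w # replicate (n_tapes M - 1) (input_tape []))"

definition answers_within :: "tm \<Rightarrow> nat list \<Rightarrow> bool \<Rightarrow> nat \<Rightarrow> bool" where
  "answers_within M w b t \<longleftrightarrow>
     (\<exists>s\<le>t. fst ((step M ^^ s) (initial_config M w)) =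
        (if b then accept_state M else reject_state M))"


section \<open>Hypergraphs as input words\<close>

text \<open>Vertex names are written in binary, least significant digit first, with the digits
  \<open>0\<close> and \<open>1\<close> represented by the symbols \<open>1\<close> and \<open>2\<close>.  Symbol \<open>3\<close> terminates a vertex name and symbol
  \<open>4\<close> terminates a list of vertices.  A hypergraph is written as the list of its vertices followed
  by its hyperedges, each as a list of vertices; all lists may be in any order.
  The size of a hypergraph is the length of such a word, which does not depend on the orders chosen.\<close>

fun binary :: "nat \<Rightarrow> nat list" where
  "binary n = (if n < 2 then [n + 1] else (n mod 2 + 1) # binary (n div 2))"

declare binary.simps [simp del]

definition encode_vertices :: "nat list \<Rightarrow> nat list" where
  "encode_vertices vs = concat (map (\<lambda>v. binary v @ [3]) vs) @ [4]"

definition encodes :: "nat list \<Rightarrow> hypergraph \<Rightarrow> bool" where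
  "encodes w H \<longleftrightarrow>
     (\<exists>vs es. distinct vs \<and> set vs = hverts H \<and>
        (\<forall>e\<in>set es. distinct e) \<and> distinct (map set es) \<and> set (map set es) = hedges H \<and>
        w = concat (map encode_vertices (vs # es)))"

end

theory Submission
  imports Defs
begin

text \<open>Call the set of hyperedges containing a vertex its type.  Up to isomorphism a hypergraph with
  \<open>m\<close> hyperedges is given by the number of vertices of each type.  If a support satisfies the
  property, a new vertex of an already occurring type can be attached as a leaf to a vertex of the
  same type, so the positive instances are closed under increasing nonzero counts.  By
  Dickson's lemma there is then a bound \<open>N\<close> such that the answer depends only on the counts truncated
  at \<open>N\<close>.  The finitely many truncated vectors with answer yes are built into a Turing machine,
  which only has to count the vertices of each type up to \<open>N\<close>, in cubic time.\<close>

section \<open>Supports and vertex types\<close>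

text \<open>\<open>P\<close> may be undecidable, so a machine cannot in general search for a graph
  and test it. All that depends on \<open>P\<close> has to shrink to one finite table per
  \<open>m\<close>, and this table is only shown to exist: the bound \<open>N\<close> comes from an
  argument by contradiction. The order on count vectors has to respect zeros. A vertex of a new type
  need not have a possible neighbour lying in all of its hyperedges, so attaching it as a leaf may
  disconnect one of them. Hence vectors are compared by \<open>c T \<le> c' T\<close> together with
  \<open>c T = 0 \<longrightarrow> c' T = 0\<close>. Dickson's lemma survives this refinement, since
  each coordinate of a sequence can be thinned out until it is always zero or never zero. As
  \<open>P\<close> and \<open>m\<close> enter the machine only through its states and transitions,
  its running time is bounded by one polynomial for all \<open>m\<close>.\<close>

lemma pair_graph_iff:
  "pair_graph G \<longleftrightarrow>
     finite (pverts G) \<and> parcs G \<subseteq> pverts G \<times> pverts G \<and> sym (parcs G) \<and> irrefl (parcs G)"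
proof
  assume "pair_graph G"
  then interpret pair_graph G .
  show "finite (pverts G) \<and> parcs G \<subseteq> pverts G \<times> pverts G \<and> sym (parcs G) \<and> irrefl (parcs G)"
    using pair_finite_verts arc_fst_in_verts arc_snd_in_verts arcs_symmetric pair_no_loops
    by (fastforce simp: sym_def irrefl_def)
next
  assume G: "finite (pverts G) \<and> parcs G \<subseteq> pverts G \<times> pverts G \<and> sym (parcs G) \<and> irrefl (parcs G)"
  then have "finite (parcs G)"
    by (meson finite_SigmaI finite_subset)
  with G show "pair_graph G"
    by unfold_locales (auto simp: symmetric_def irrefl_def)
qed

text \<open>Connectivity of the subgraph induced by \<open>S\<close>, stated for bare relations. The
  condition \<open>S \<noteq> {}\<close> mirrors the library notion, under which the empty graph is
  not connected.\<close>

definition spans :: "'a rel \<Rightarrow> 'a set \<Rightarrow> bool" where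
  "spans R S \<longleftrightarrow> S \<noteq> {} \<and> (\<forall>u\<in>S. \<forall>v\<in>S. (u, v) \<in> (Restr R S)\<^sup>*)"

lemma rtrancl_on_Restr:
  assumes "u \<in> S"
  shows "(u, v) \<in> rtrancl_on S (Restr R S) \<longleftrightarrow> (u, v) \<in> (Restr R S)\<^sup>*"
proof
  assume "(u, v) \<in> (Restr R S)\<^sup>*"
  then show "(u, v) \<in> rtrancl_on S (Restr R S)"
    by induction (use assms in \<open>auto intro: rtrancl_on_into_rtrancl_on\<close>)
qed (rule rtrancl_on_rtranclI)

lemma connected_induce_iff:
  assumes "pair_graph G"
  shows "Digraph_Component.connected (with_proj G \<restriction> S) \<longleftrightarrow> spans (parcs G) S"
proof -
  have "(arcs_ends (with_proj G \<restriction> S))\<^sup>s = Restr (parcs G) S"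
    using assms by (auto simp: pair_graph_iff symcl_def arcs_ends_conv induce_subgraph_def sym_def)
  then show ?thesis
    by (simp add: connected_conv spans_def rtrancl_on_Restr)
qed

lemma spans_map_prod:
  assumes "spans R S"
  shows "spans (map_prod \<phi> \<phi> ` R) (\<phi> ` S)"
proof -
  have "(\<phi> u, \<phi> v) \<in> (Restr (map_prod \<phi> \<phi> ` R) (\<phi> ` S))\<^sup>*" if "(u, v) \<in> (Restr R S)\<^sup>*" for u v
    using that
  proof induction
    case (step y z)
    then have "(\<phi> y, \<phi> z) \<in> Restr (map_prod \<phi> \<phi> ` R) (\<phi> ` S)"
      by force
    with step.IH show ?case
      by (rule rtrancl_into_rtrancl)
  qed simp
  with assms show ?thesis
    by (auto simp: spans_def)
qed

text \<open>Restricted walks stay walks when arcs are added; this covers the hyperedges that a new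
  leaf does not meet.\<close>

lemma spans_mono:
  assumes "spans R S" "R \<subseteq> R'"
  shows "spans R' S"
proof -
  have "(Restr R S)\<^sup>* \<subseteq> (Restr R' S)\<^sup>*"
    using assms(2) by (intro rtrancl_mono) auto
  with assms(1) show ?thesis
    by (auto simp: spans_def)
qed

text \<open>Every walk between two vertices of \<open>insert v S\<close> can be routed through
  \<open>u\<close>.\<close>

lemma spans_insert:
  assumes "spans R S" "u \<in> S" "(u, v) \<in> R" "(v, u) \<in> R"
  shows "spans R (insert v S)"
proof -
  let ?Q = "Restr R (insert v S)"
  have sub: "(Restr R S)\<^sup>* \<subseteq> ?Q\<^sup>*"
    by (intro rtrancl_mono) auto
  have to_u: "(x, u) \<in> ?Q\<^sup>*" and from_u: "(u, x) \<in> ?Q\<^sup>*" if "x \<in> insert v S" for x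
    using that assms sub by (auto simp: spans_def)
  have "(x, y) \<in> ?Q\<^sup>*" if "x \<in> insert v S" "y \<in> insert v S" for x y
    using to_u[OF that(1)] from_u[OF that(2)] by (rule rtrancl_trans)
  then show ?thesis
    by (auto simp: spans_def)
qed

text \<open>A hypergraph with hyperedges indexed by \<open>J\<close> is given by its vertex set \<open>V\<close> and the map \<open>\<tau>\<close>
  that sends a vertex to the set of indices of the hyperedges containing it, its type.\<close>

definition typed_support :: "(ngraph \<Rightarrow> bool) \<Rightarrow> 'j set \<Rightarrow> nat set \<Rightarrow> (nat \<Rightarrow> 'j set) \<Rightarrow> bool" where
  "typed_support P J V \<tau> \<longleftrightarrow>
     (\<exists>G. pair_graph G \<and> pverts G = V \<and> P G \<and> (\<forall>j\<in>J. spans (parcs G) {v \<in> V. j \<in> \<tau> v}))"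

text \<open>The supporting graph is transported along \<open>\<phi>\<close>. This is where
  isomorphism invariance of \<open>P\<close> enters.\<close>

lemma typed_support_iso:
  assumes P: "graph_property P" and sup: "typed_support P J V \<tau>"
    and inj: "inj_on \<phi> V" and \<tau>: "\<And>v. v \<in> V \<Longrightarrow> \<tau>' (\<phi> v) = \<tau> v"
  shows "typed_support P J (\<phi> ` V) \<tau>'"
proof -
  obtain G where G: "pair_graph G" "pverts G = V" "P G"
    and spans: "\<forall>j\<in>J. spans (parcs G) {v \<in> V. j \<in> \<tau> v}"
    using sup by (auto simp: typed_support_def)
  have arcs: "parcs G \<subseteq> V \<times> V"
    using G by (simp add: pair_graph_iff)
  define G' where "G' = \<lparr>pverts = \<phi> ` V, parcs = map_prod \<phi> \<phi> ` parcs G\<rparr>"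
  have G': "pair_graph G'"
    using G inj unfolding pair_graph_iff G'_def
    by (auto simp: sym_def irrefl_def inj_on_def) (metis SigmaD1 SigmaD2 subsetD)+
  have "digraph_iso (with_proj G) (with_proj G')"
  proof -
    define f where "f = \<lparr>iso_verts = \<phi>, iso_arcs = map_prod \<phi> \<phi>, iso_head = snd, iso_tail = fst\<rparr>"
    have "inj_on (map_prod \<phi> \<phi>) (parcs G)"
      using map_prod_inj_on[OF inj inj] arcs by (rule inj_on_subset)
    then have "pre_digraph.digraph_isomorphism (with_proj G) f"
      using G inj arcs
      by (auto simp: pre_digraph.digraph_isomorphism_def f_def wf_digraph_wp_iff pair_wf_digraph_def)
    moreover have "with_proj G' = app_iso f (with_proj G)"
      by (simp add: with_proj_def app_iso_def f_def G'_def G)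
    ultimately show ?thesis
      unfolding digraph_iso_def by blast
  qed
  with P G G' have "P G'"
    unfolding graph_property_def by blast
  moreover have "spans (parcs G') {v \<in> \<phi> ` V. j \<in> \<tau>' v}" if "j \<in> J" for j
  proof -
    have "{v \<in> \<phi> ` V. j \<in> \<tau>' v} = \<phi> ` {v \<in> V. j \<in> \<tau> v}"
      using \<tau> by auto
    with spans that show ?thesis
      by (simp add: G'_def spans_map_prod)
  qed
  ultimately show ?thesis
    using G' unfolding typed_support_def by (intro exI[of _ G']) (auto simp: G'_def)
qed

text \<open>Because \<open>u\<close> and \<open>v\<close> have equal types, each hyperedge that
  receives \<open>v\<close> already contains the only neighbour \<open>u\<close> of the leaf and
  stays connected; the other hyperedges keep their vertices.\<close>

lemma typed_support_insert_twin:
  assumes P: "closed_under_adding_leaves P" and sup: "typed_support P J V \<tau>"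
    and u: "u \<in> V" and v: "v \<notin> V" and twins: "\<tau> v = \<tau> u"
  shows "typed_support P J (insert v V) \<tau>"
proof -
  obtain G where G: "pair_graph G" "pverts G = V" "P G"
    and spans: "\<forall>j\<in>J. spans (parcs G) {v \<in> V. j \<in> \<tau> v}"
    using sup by (auto simp: typed_support_def)
  let ?G = "add_leaf G u v"
  have "pair_graph ?G"
    using G u v by (auto simp: pair_graph_iff add_leaf_def sym_def irrefl_def)
  moreover have "P ?G"
    using P G u v unfolding closed_under_adding_leaves_def by blast
  moreover have "spans (parcs ?G) {x \<in> insert v V. j \<in> \<tau> x}" if "j \<in> J" for j
  proof -
    have sp: "spans (parcs ?G) {x \<in> V. j \<in> \<tau> x}"
      using spans that by (auto simp: add_leaf_def intro: spans_mono)
    show ?thesis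
    proof (cases "j \<in> \<tau> v")
      case True
      then have "spans (parcs ?G) (insert v {x \<in> V. j \<in> \<tau> x})"
        using sp u twins by (intro spans_insert[of _ _ u]) (auto simp: add_leaf_def)
      also have "insert v {x \<in> V. j \<in> \<tau> x} = {x \<in> insert v V. j \<in> \<tau> x}"
        using True by auto
      finally show ?thesis .
    next
      case False
      then have "{x \<in> insert v V. j \<in> \<tau> x} = {x \<in> V. j \<in> \<tau> x}"
        by auto
      with sp show ?thesis
        by simp
    qed
  qed
  ultimately show ?thesis
    using G unfolding typed_support_def by (intro exI[of _ ?G]) (auto simp: add_leaf_def)
qed

lemma typed_support_extend:
  assumes P: "closed_under_adding_leaves P" and sup: "typed_support P J V \<tau>"
    and "finite W" "\<And>w. w \<in> W \<Longrightarrow> \<exists>u\<in>V. \<tau> w = \<tau> u"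
  shows "typed_support P J (V \<union> W) \<tau>"
  using assms(3,4)
proof (induction W)
  case empty
  show ?case using sup by simp
next
  case (insert w W)
  then have IH: "typed_support P J (V \<union> W) \<tau>"
    by simp
  show ?case
  proof (cases "w \<in> V")
    case True
    with IH show ?thesis by (simp add: insert_absorb)
  next
    case False
    obtain u where "u \<in> V" "\<tau> w = \<tau> u"
      using insert.prems by auto
    with typed_support_insert_twin[OF P IH, of u w] False insert.hyps show ?thesis
      by auto
  qed
qed

section \<open>Monotonicity in the type counts\<close>

definition type_count :: "nat set \<Rightarrow> (nat \<Rightarrow> 'j set) \<Rightarrow> 'j set \<Rightarrow> nat" where
  "type_count V \<tau> T = card {v \<in> V. \<tau> v = T}"

text \<open>The inequalities allow an injection of \<open>V\<close> into \<open>V'\<close> that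
  preserves types, so the image of \<open>V\<close> has a support. The condition on zeros gives
  every remaining vertex of \<open>V'\<close> a twin in that image, to which it is attached as a
  leaf.\<close>

lemma typed_support_mono:
  assumes P: "graph_property P" "closed_under_adding_leaves P"
    and sup: "typed_support P J V \<tau>" and fin: "finite V" "finite V'"
    and le: "\<And>T. type_count V \<tau> T \<le> type_count V' \<tau>' T"
    and zero: "\<And>T. type_count V \<tau> T = 0 \<Longrightarrow> type_count V' \<tau>' T = 0"
  shows "typed_support P J V' \<tau>'"
proof -
  have "\<forall>T. \<exists>g. inj_on g {v \<in> V. \<tau> v = T} \<and> g ` {v \<in> V. \<tau> v = T} \<subseteq> {v \<in> V'. \<tau>' v = T}"
  proof
    fix T
    show "\<exists>g. inj_on g {v \<in> V. \<tau> v = T} \<and> g ` {v \<in> V. \<tau> v = T} \<subseteq> {v \<in> V'. \<tau>' v = T}"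
      using le[of T] fin card_le_inj[of "{v \<in> V. \<tau> v = T}" "{v \<in> V'. \<tau>' v = T}"]
      by (auto simp: type_count_def)
  qed
  from choice[OF this] obtain g where g: "\<And>T. inj_on (g T) {v \<in> V. \<tau> v = T}"
    "\<And>T. g T ` {v \<in> V. \<tau> v = T} \<subseteq> {v \<in> V'. \<tau>' v = T}"
    by blast
  \<comment> \<open>The injections for the single types glue to an injection, since
    \<open>g T\<close> maps into the vertices of type \<open>T\<close> and these sets are
    disjoint.\<close>
  define \<phi> where "\<phi> v = g (\<tau> v) v" for v
  have \<phi>: "\<phi> v \<in> V'" "\<tau>' (\<phi> v) = \<tau> v" if "v \<in> V" for v
    using g(2)[of "\<tau> v"] that by (auto simp: \<phi>_def)
  have "inj_on \<phi> V"
  proof (rule inj_onI)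
    fix x y assume "x \<in> V" "y \<in> V" "\<phi> x = \<phi> y"
    moreover from this have "\<tau> x = \<tau> y"
      using \<phi>(2) by metis
    ultimately show "x = y"
      using g(1)[of "\<tau> y"] by (auto simp: \<phi>_def inj_on_def)
  qed
  then have "typed_support P J (\<phi> ` V) \<tau>'"
    using typed_support_iso[OF P(1) sup] \<phi>(2) by blast
  moreover have "\<exists>u\<in>\<phi> ` V. \<tau>' w = \<tau>' u" if "w \<in> V'" for w
  proof -
    have "type_count V \<tau> (\<tau>' w) \<noteq> 0"
      using zero[of "\<tau>' w"] that fin by (auto simp: type_count_def)
    then obtain v where "v \<in> V" "\<tau> v = \<tau>' w"
      using fin by (auto simp: type_count_def)
    with \<phi> show ?thesis by auto
  qed
  ultimately have "typed_support P J (\<phi> ` V \<union> V') \<tau>'"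
    using typed_support_extend[OF P(2)] fin(2) by blast
  moreover have "\<phi> ` V \<union> V' = V'"
    using \<phi>(1) by auto
  ultimately show ?thesis
    by simp
qed

section \<open>Truncated type counts\<close>

text \<open>A monotone subsequence is cut off at the front. If it increases, the cut is at its first
  visible nonzero value, if any; if it decreases, it is constant from a minimum on.\<close>

lemma nat_seq_subseq_mono:
  fixes a :: "nat \<Rightarrow> nat"
  obtains r :: "nat \<Rightarrow> nat" where "strict_mono r"
    and "\<And>i j. i \<le> j \<Longrightarrow> a (r i) \<le> a (r j) \<and> (a (r i) = 0 \<longrightarrow> a (r j) = 0)"
proof -
  obtain r where r: "strict_mono (r :: nat \<Rightarrow> nat)" "monoseq (\<lambda>n. a (r n))"
    using seq_monosub by blast
  have "\<exists>k. \<forall>i j. k \<le> i \<and> i \<le> j \<longrightarrow> a (r i) \<le> a (r j) \<and> (a (r i) = 0 \<longrightarrow> a (r j) = 0)"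
    using r(2) unfolding monoseq_def
  proof
    assume inc: "\<forall>m n. m \<le> n \<longrightarrow> a (r m) \<le> a (r n)"
    show ?thesis
    proof (cases "\<exists>k. a (r k) \<noteq> 0")
      case True
      then obtain k where "a (r k) \<noteq> 0" by blast
      with inc show ?thesis
        by (intro exI[of _ k]) (metis le_0_eq)
    qed (use inc in auto)
  next
    assume dec: "\<forall>m n. m \<le> n \<longrightarrow> a (r n) \<le> a (r m)"
    obtain k where "\<And>n. a (r k) \<le> a (r n)"
      using ex_has_least_nat[of "\<lambda>_. True" _ "\<lambda>n. a (r n)"] by auto
    with dec have "a (r i) = a (r k)" if "k \<le> i" for i
      using that by (simp add: order_antisym)
    then have "a (r i) = a (r j)" if "k \<le> i" "i \<le> j" for i j
      using that le_trans by metis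
    then show ?thesis
      by (intro exI[of _ k]) (metis order_refl)
  qed
  then obtain k where k: "\<And>i j. k \<le> i \<Longrightarrow> i \<le> j \<Longrightarrow> a (r i) \<le> a (r j) \<and> (a (r i) = 0 \<longrightarrow> a (r j) = 0)"
    by blast
  show thesis
  proof
    show "strict_mono (\<lambda>i. r (k + i))"
      using r(1) by (auto simp: strict_mono_def)
    show "a (r (k + i)) \<le> a (r (k + j)) \<and> (a (r (k + i)) = 0 \<longrightarrow> a (r (k + j)) = 0)"
      if "i \<le> j" for i j
      using k[of "k + i" "k + j"] that by simp
  qed
qed

text \<open>The subsequence is refined once for each coordinate; earlier coordinates stay ordered
  under further thinning.\<close>

lemma Dickson_subseq:
  fixes a :: "nat \<Rightarrow> 'i \<Rightarrow> nat"
  assumes "finite I"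
  shows "\<exists>r :: nat \<Rightarrow> nat. strict_mono r \<and>
    (\<forall>T\<in>I. \<forall>i j. i \<le> j \<longrightarrow> a (r i) T \<le> a (r j) T \<and> (a (r i) T = 0 \<longrightarrow> a (r j) T = 0))"
  using assms
proof induction
  case empty
  show ?case by (intro exI[of _ id]) (auto simp: strict_mono_def)
next
  case (insert S I)
  then obtain r :: "nat \<Rightarrow> nat" where r: "strict_mono r"
    "\<forall>T\<in>I. \<forall>i j. i \<le> j \<longrightarrow> a (r i) T \<le> a (r j) T \<and> (a (r i) T = 0 \<longrightarrow> a (r j) T = 0)"
    by blast
  obtain s :: "nat \<Rightarrow> nat" where s: "strict_mono s"
    "\<And>i j. i \<le> j \<Longrightarrow> a (r (s i)) S \<le> a (r (s j)) S \<and> (a (r (s i)) S = 0 \<longrightarrow> a (r (s j)) S = 0)"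
    using nat_seq_subseq_mono[of "\<lambda>n. a (r n) S"] by blast
  have "strict_mono (\<lambda>i. r (s i))"
    using r(1) s(1) by (simp add: strict_mono_def)
  moreover have "a (r (s i)) T \<le> a (r (s j)) T \<and> (a (r (s i)) T = 0 \<longrightarrow> a (r (s j)) T = 0)"
    if "T \<in> insert S I" "i \<le> j" for T i j
  proof (cases "T = S")
    case True
    with s(2)[OF that(2)] show ?thesis by simp
  next
    case False
    moreover have "s i \<le> s j"
      using s(1) that(2) by (simp add: strict_mono_less_eq)
    ultimately show ?thesis
      using r(2)[rule_format, of T "s i" "s j"] that(1) by simp
  qed
  ultimately show ?case
    by (intro exI[of _ "\<lambda>i. r (s i)"] conjI ballI allI impI) simp_all
qed

text \<open>\<open>B\<close> is the universe of admissible vectors and \<open>A\<close> its upward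
  closed part. If every \<open>N\<close> failed, the failures would form sequences \<open>a\<close>
  in \<open>A\<close> and \<open>b\<close> outside \<open>A\<close> with equal truncations, and an
  ordered subsequence of \<open>a\<close> would force some \<open>b N\<close> into
  \<open>A\<close>.\<close>

lemma truncation_threshold:
  fixes A :: "('i \<Rightarrow> nat) set"
  assumes "finite I"
    and up: "\<And>c c'. c \<in> A \<Longrightarrow> c' \<in> B \<Longrightarrow>
      (\<And>T. T \<in> I \<Longrightarrow> c T \<le> c' T \<and> (c T = 0 \<longrightarrow> c' T = 0)) \<Longrightarrow> c' \<in> A"
  shows "\<exists>N. \<forall>c\<in>A. \<forall>c'\<in>B. (\<forall>T\<in>I. min N (c T) = min N (c' T)) \<longrightarrow> c' \<in> A"
proof (rule ccontr)
  assume "\<not> ?thesis"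
  then have "\<forall>N. \<exists>c c'. c \<in> A \<and> c' \<in> B \<and> c' \<notin> A \<and> (\<forall>T\<in>I. min N (c T) = min N (c' T))"
    by blast
  then obtain a b where a: "\<And>N. a N \<in> A" and b: "\<And>N. b N \<in> B" "\<And>N. b N \<notin> A"
    and ab: "\<And>N T. T \<in> I \<Longrightarrow> min N (a N T) = min N (b N T)"
    by metis
  obtain r :: "nat \<Rightarrow> nat" where r: "strict_mono r" "\<And>T i j. T \<in> I \<Longrightarrow> i \<le> j \<Longrightarrow>
      a (r i) T \<le> a (r j) T \<and> (a (r i) T = 0 \<longrightarrow> a (r j) T = 0)"
    using Dickson_subseq[OF \<open>finite I\<close>, of a] by blast
  \<comment> \<open>Chosen to exceed all entries of \<open>a (r 0)\<close>. As
    \<open>j \<le> r j\<close>, truncation at \<open>r j\<close> does not affect these entries, so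
    \<open>a (r 0) \<le> a (r j)\<close> passes to \<open>b (r j)\<close>; as \<open>r j\<close> is
    positive, so do zeros.\<close>
  define j where "j = Suc (\<Sum>T\<in>I. a (r 0) T)"
  have "b (r j) \<in> A"
  proof (rule up[OF a[of "r 0"] b(1)])
    fix T assume T: "T \<in> I"
    then have "a (r 0) T < j"
      using \<open>finite I\<close> by (simp add: j_def le_imp_less_Suc member_le_sum)
    also have "j \<le> r j"
      using r(1) by (rule strict_mono_imp_increasing)
    finally show "a (r 0) T \<le> b (r j) T \<and> (a (r 0) T = 0 \<longrightarrow> b (r j) T = 0)"
      using r(2)[OF T, of 0 j] ab[OF T, of "r j"] by (auto simp: min_def split: if_splits)
  qed
  with b(2) show False
    by blast
qed

lemma typed_support_threshold:
  assumes P: "graph_property P" "closed_under_adding_leaves P" and "finite K"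
  obtains N where "\<And>V V' \<tau> \<tau>'.
    \<lbrakk>finite V; finite V'; \<tau> ` V \<subseteq> Pow K; \<tau>' ` V' \<subseteq> Pow K;
     \<And>T. min N (type_count V \<tau> T) = min N (type_count V' \<tau>' T); typed_support P J V \<tau>\<rbrakk>
    \<Longrightarrow> typed_support P J V' \<tau>'"
proof -
  define B where "B = {type_count V \<tau> | V \<tau>. finite V \<and> \<tau> ` V \<subseteq> Pow K}"
  define A where
    "A = {type_count V \<tau> | V \<tau>. finite V \<and> \<tau> ` V \<subseteq> Pow K \<and> typed_support P J V \<tau>}"
  have outside: "type_count V \<tau> T = 0" if "\<tau> ` V \<subseteq> Pow K" "T \<notin> Pow K" for V :: "nat set" and \<tau> T
  proof -
    have "{v \<in> V. \<tau> v = T} = {}" using that by auto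
    then show ?thesis by (simp only: type_count_def card.empty)
  qed
  have mono: "typed_support P J V' \<tau>'"
    if "type_count V \<tau> = c" "type_count V' \<tau>' = c'" "finite V" "finite V'"
      "\<tau> ` V \<subseteq> Pow K" "\<tau>' ` V' \<subseteq> Pow K" "typed_support P J V \<tau>"
      "\<And>T. T \<in> Pow K \<Longrightarrow> c T \<le> c' T \<and> (c T = 0 \<longrightarrow> c' T = 0)"
    for V V' \<tau> \<tau>' c c'
  proof (rule typed_support_mono[OF P that(7,3,4)])
    fix T
    have "type_count V \<tau> T \<le> type_count V' \<tau>' T \<and>
        (type_count V \<tau> T = 0 \<longrightarrow> type_count V' \<tau>' T = 0)"
    proof (cases "T \<in> Pow K")
      case True
      with that(8)[OF this] show ?thesis by (simp add: that(1,2))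
    next
      case False
      with outside[OF that(5)] outside[OF that(6)] show ?thesis by simp
    qed
    then show "type_count V \<tau> T \<le> type_count V' \<tau>' T"
      and "type_count V \<tau> T = 0 \<Longrightarrow> type_count V' \<tau>' T = 0"
      by simp_all
  qed
  have "\<exists>N. \<forall>c\<in>A. \<forall>c'\<in>B. (\<forall>T\<in>Pow K. min N (c T) = min N (c' T)) \<longrightarrow> c' \<in> A"
  proof (rule truncation_threshold)
    fix c c'
    assume c: "c \<in> A" and c': "c' \<in> B"
      and le: "\<And>T. T \<in> Pow K \<Longrightarrow> c T \<le> c' T \<and> (c T = 0 \<longrightarrow> c' T = 0)"
    obtain V \<tau> where V: "type_count V \<tau> = c" "finite V" "\<tau> ` V \<subseteq> Pow K" "typed_support P J V \<tau>"
      using c unfolding A_def by blast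
    obtain V' \<tau>' where V': "type_count V' \<tau>' = c'" "finite V'" "\<tau>' ` V' \<subseteq> Pow K"
      using c' unfolding B_def by blast
    have "typed_support P J V' \<tau>'"
      by (rule mono[OF V(1) V'(1) V(2) V'(2) V(3) V'(3) V(4) le])
    with V' show "c' \<in> A"
      unfolding A_def by blast
  qed (use \<open>finite K\<close> in simp)
  then obtain N where
    N: "\<forall>c\<in>A. \<forall>c'\<in>B. (\<forall>T\<in>Pow K. min N (c T) = min N (c' T)) \<longrightarrow> c' \<in> A"
    by blast
  show thesis
  proof
    fix V V' \<tau> \<tau>'
    assume *: "finite V" "finite V'" "\<tau> ` V \<subseteq> Pow K" "\<tau>' ` V' \<subseteq> Pow K"
      "\<And>T. min N (type_count V \<tau> T) = min N (type_count V' \<tau>' T)" "typed_support P J V \<tau>"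
    have "type_count V \<tau> \<in> A" "type_count V' \<tau>' \<in> B"
      using * unfolding A_def B_def by blast+
    with N *(5) have "type_count V' \<tau>' \<in> A"
      by blast
    \<comment> \<open>Membership in \<open>A\<close> only says that the vector is realized by some
      supported pair; \<open>mono\<close> with equal counts moves the support to
      \<open>V'\<close>.\<close>
    then obtain U \<sigma> where U: "type_count V' \<tau>' = type_count U \<sigma>" "finite U" "\<sigma> ` U \<subseteq> Pow K"
      "typed_support P J U \<sigma>"
      unfolding A_def by blast
    show "typed_support P J V' \<tau>'"
      by (rule mono[OF refl U(1) U(2) *(2) U(3) *(4) U(4)]) simp
  qed
qed

section \<open>Two-tape machines\<close>

text \<open>\<open>t\<close> is only an upper bound, so bounds for consecutive phases can be added
  and rounded up.\<close>

definition reaches :: "('c \<Rightarrow> 'c) \<Rightarrow> nat \<Rightarrow> 'c \<Rightarrow> 'c \<Rightarrow> bool" where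
  "reaches f t x y \<longleftrightarrow> (\<exists>s\<le>t. (f ^^ s) x = y)"

lemma reaches_refl: "reaches f t x x"
  unfolding reaches_def by (intro exI[of _ 0]) simp

lemma reaches_mono: "reaches f t x y \<Longrightarrow> t \<le> t' \<Longrightarrow> reaches f t' x y"
  unfolding reaches_def using order_trans by blast

lemma reaches_trans:
  assumes "reaches f t x y" "reaches f t' y z"
  shows "reaches f (t + t') x z"
proof -
  obtain s s' where "s \<le> t" "s' \<le> t'" "(f ^^ s) x = y" "(f ^^ s') y = z"
    using assms by (auto simp: reaches_def)
  then show ?thesis
    unfolding reaches_def by (intro exI[of _ "s' + s"]) (simp add: funpow_add)
qed

lemma reaches_one: "f x = y \<Longrightarrow> reaches f (Suc t) x y"
  unfolding reaches_def by (intro exI[of _ 1]) simp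

lemma reaches_step:
  assumes "f x = y" "reaches f t y z"
  shows "reaches f (Suc t) x z"
  using reaches_trans[OF reaches_one[where f = f, OF assms(1), of 0] assms(2)] by simp

text \<open>An intermediate model with an arbitrary state type, so that states can be tuples
  carrying counters and sets.\<close>

fun two_tape_step ::
  "('s \<Rightarrow> nat \<Rightarrow> nat \<Rightarrow> 's \<times> nat \<times> move \<times> move) \<Rightarrow> 's set \<Rightarrow> 's \<times> tape \<times> tape \<Rightarrow> 's \<times> tape \<times> tape"
where
  "two_tape_step \<delta> F (s, (t, i), (u, j)) =
     (if s \<in> F then (s, (t, i), (u, j))
      else let (s', x, d, e) = \<delta> s (t i) (u j)
           in (s', (t, i + offset d), (u(j := x), j + offset e)))"

text \<open>States are numbered by a bijection from \<open>Q\<close>, and the first tape is kept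
  fixed by writing back the symbol read. Since \<open>x \<in> {a, b}\<close>, no symbol appears that
  was not read, and five symbols suffice.\<close>

lemma two_tape_machine:
  assumes Q: "finite Q" "start \<in> Q" "acc \<in> Q" "rej \<in> Q" "acc \<noteq> rej"
    and closed: "\<And>s a b s' x d e. s \<in> Q \<Longrightarrow> \<delta> s a b = (s', x, d, e) \<Longrightarrow> s' \<in> Q \<and> x \<in> {a, b}"
  obtains M where "turing_machine M"
    and "\<And>w b t cfg.
      reaches (two_tape_step \<delta> {acc, rej}) t (start, input_tape w, input_tape []) cfg \<Longrightarrow>
      fst cfg = (if b then acc else rej) \<Longrightarrow> answers_within M w b t"
proof -
  obtain h where h: "bij_betw h Q {..<card Q}"
    using ex_bij_betw_finite_nat[OF Q(1)] by (auto simp: atLeast0LessThan)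
  define g where "g = inv_into Q h"
  have gh: "g (h s) = s" if "s \<in> Q" for s
    using that h by (simp add: g_def bij_betw_def)
  have h_less: "h s < card Q" if "s \<in> Q" for s
    using that h by (auto simp: bij_betw_def)
  have g_in: "g q \<in> Q" if "q < card Q" for q
    using that h by (auto simp: g_def bij_betw_def intro: inv_into_into)
  have h_eq: "h s = h s' \<longleftrightarrow> s = s'" if "s \<in> Q" "s' \<in> Q" for s s'
    using that gh by metis
  define M where "M = \<lparr>n_tapes = 2, n_symbols = 5, n_states = card Q, start_state = h start,
    accept_state = h acc, reject_state = h rej,
    transition = (\<lambda>q syms. let (s, x, d, e) = \<delta> (g q) (syms ! 0) (syms ! 1)
                           in (h s, [(syms ! 0, d), (x, e)]))\<rparr>"
  have "turing_machine M"
    unfolding turing_machine_def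
  proof (intro conjI allI impI; (elim conjE)?)
    fix q syms q' acts
    assume q: "q < n_states M" and syms: "length syms = n_tapes M" "set syms \<subseteq> {..<n_symbols M}"
      and tr: "transition M q syms = (q', acts)"
    obtain s x d e where sx: "\<delta> (g q) (syms ! 0) (syms ! 1) = (s, x, d, e)"
      by (metis prod_cases4)
    have cl: "s \<in> Q \<and> x \<in> {syms ! 0, syms ! 1}"
      using closed[OF g_in sx] q by (simp add: M_def)
    have "syms ! 0 \<in> set syms" "syms ! 1 \<in> set syms"
      using syms(1) by (simp_all add: M_def)
    then have "syms ! 0 < 5" "syms ! 1 < 5"
      using syms(2) by (auto simp: M_def)
    moreover have "q' = h s" "acts = [(syms ! 0, d), (x, e)]"
      using tr sx by (auto simp: M_def)
    ultimately show "q' < n_states M" "length acts = n_tapes M" "fst ` set acts \<subseteq> {..<n_symbols M}"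
      using cl h_less by (auto simp: M_def)
  qed (use Q h_less h_eq in \<open>auto simp: M_def\<close>)
  moreover have "answers_within M w b t"
    if run: "reaches (two_tape_step \<delta> {acc, rej}) t (start, input_tape w, input_tape []) cfg"
      and fin: "fst cfg = (if b then acc else rej)" for w b t cfg
  proof -
    define emb :: "'a \<times> tape \<times> tape \<Rightarrow> config" where "emb = (\<lambda>(s, x, y). (h s, [x, y]))"
    let ?step = "two_tape_step \<delta> {acc, rej}"
    \<comment> \<open>Staying in \<open>Q\<close> is part of the simulation claim, because the
      numbering \<open>h\<close> is invertible only there.\<close>
    have sim: "step M (emb c) = emb (?step c) \<and> fst (?step c) \<in> Q" if "fst c \<in> Q" for c
    proof -
      obtain s x i y j where c: "c = (s, (x, i), (y, j))"
        by (metis prod.exhaust)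
      obtain s' z d e where sz: "\<delta> s (x i) (y j) = (s', z, d, e)"
        by (metis prod_cases4)
      have s: "s \<in> Q" using that c by simp
      have "s' \<in> Q" using closed[OF s sz] by simp
      then show ?thesis
        using s sz gh[OF s] h_eq[OF s Q(3)] h_eq[OF s Q(4)]
        by (auto simp: c emb_def M_def Let_def)
    qed
    have "(step M ^^ n) (emb c) = emb ((?step ^^ n) c) \<and> fst ((?step ^^ n) c) \<in> Q"
      if "fst c \<in> Q" for n c
      using that by (induction n) (use sim in auto)
    note sims = this[of "(start, input_tape w, input_tape [])"]
    have init: "initial_config M w = emb (start, input_tape w, input_tape [])"
      by (simp add: initial_config_def emb_def M_def)
    obtain s where "s \<le> t" "(?step ^^ s) (start, input_tape w, input_tape []) = cfg"
      using run by (auto simp: reaches_def)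
    with sims[of s] Q(2) have "(step M ^^ s) (initial_config M w) = emb cfg"
      by (simp add: init)
    then show ?thesis
      unfolding answers_within_def using \<open>s \<le> t\<close> fin
      by (intro exI[of _ s]) (auto simp: emb_def M_def split: prod.splits)
  qed
  ultimately show thesis
    using that by blast
qed

section \<open>Words on tapes and binary vertex names\<close>

primrec reads :: "(int \<Rightarrow> nat) \<Rightarrow> int \<Rightarrow> nat list \<Rightarrow> bool" where
  "reads W i [] \<longleftrightarrow> True"
| "reads W i (x # xs) \<longleftrightarrow> W i = x \<and> reads W (i + 1) xs"

lemma reads_append:
  "reads W i (xs @ ys) \<longleftrightarrow> reads W i xs \<and> reads W (i + int (length xs)) ys"
  by (induction xs arbitrary: i) (auto simp: add.assoc)

lemma reads_iff_nth: "reads W i xs \<longleftrightarrow> (\<forall>k<length xs. W (i + int k) = xs ! k)"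
proof (induction xs arbitrary: i)
  case (Cons x xs)
  show ?case
    by (auto simp: Cons.IH All_less_Suc2 add_ac)
qed simp

lemma reads_nonzero: "reads W 0 w \<Longrightarrow> 0 \<notin> set w \<Longrightarrow> p < length w \<Longrightarrow> W (int p) \<noteq> 0"
  by (metis add_0 nth_mem reads_iff_nth)

lemma set_binary: "set (binary v) \<subseteq> {1, 2}"
  by (induction v rule: binary.induct) (subst binary.simps, auto)

lemma binary_neq_Nil: "binary v \<noteq> []"
  by (subst binary.simps) simp

text \<open>A left inverse of \<open>binary\<close>, introduced to show it injective: comparing
  names symbol by symbol decides equality of vertices. Digits are stored shifted by one, hence
  \<open>x - 1\<close>.\<close>

primrec binary_value :: "nat list \<Rightarrow> nat" where
  "binary_value [] = 0"
| "binary_value (x # xs) = (x - 1) + 2 * binary_value xs"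

lemma binary_value_binary: "binary_value (binary v) = v"
  by (induction v rule: binary.induct) (subst binary.simps, auto)

lemma binary_eq_iff: "binary v = binary u \<longleftrightarrow> v = u"
  by (metis binary_value_binary)

section \<open>A machine counting the vertices of each type\<close>

text \<open>\<open>Copy\<close> and \<open>Back\<close> prepare the second tape. \<open>Skip\<close>
  and \<open>Rewind\<close> finish the comparison of two names, one mode for each head.
  \<open>Advance\<close> and \<open>Restart\<close> likewise finish the round of one vertex.\<close>

datatype mode = Copy | Back | Compare | Skip | Rewind | Advance | Restart | Accept | Reject

type_synonym state = "mode \<times> (nat set \<Rightarrow> nat) \<times> nat set \<times> nat"

definition bump :: "nat \<Rightarrow> nat set \<Rightarrow> (nat set \<Rightarrow> nat) \<Rightarrow> nat set \<Rightarrow> nat" where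
  "bump N T c = c(T := min N (c T + 1))"

text \<open>The other components are reset so that accepting and rejecting are one state each, as
  \<open>two_tape_machine\<close> requires.\<close>

definition verdict :: "bool \<Rightarrow> state" where
  "verdict b = (if b then Accept else Reject, \<lambda>_. 0, {}, 0)"

text \<open>After the input has been copied to the second tape, neither tape is modified any more.  The
  first head stands at a vertex name of the initial vertex list while the second head passes over
  the whole word and the names it meets are compared with that vertex.  In a state \<open>(q, c, S, k)\<close> the
  second head is in the \<open>k\<close>-th list of the word, \<open>S\<close> collects the lists found to contain the current
  vertex, and \<open>c\<close> counts the vertices already treated by type, up to the bound \<open>N\<close>.  The
  bound \<open>K\<close> only serves to keep the set of states finite.\<close>

fun census :: "nat \<Rightarrow> nat \<Rightarrow> ((nat set \<Rightarrow> nat) \<Rightarrow> bool) \<Rightarrow> state \<Rightarrow> nat \<Rightarrow> nat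
    \<Rightarrow> state \<times> nat \<times> move \<times> move" where
  "census K N D (Copy, c, S, k) a b =
     (if a = 0 then ((Back, c, S, k), b, Move_Left, Move_Left)
      else ((Copy, c, S, k), a, Move_Right, Move_Right))"
| "census K N D (Back, c, S, k) a b =
     (if b = 0 then ((Compare, c, S, k), b, Move_Right, Move_Right)
      else ((Back, c, S, k), b, Move_Left, Move_Left))"
| "census K N D (Compare, c, S, k) a b =
     (if a = 4 then (verdict (D c), b, Stay, Stay)
      else if b = 0 then ((Advance, bump N S c, {}, 0), b, Stay, Move_Left)
      else if b = 4 then ((Compare, c, S, min K (k + 1)), b, Stay, Move_Right)
      else if a \<noteq> b then ((Skip, c, S, k), b, Move_Left, Stay)
      else if a = 3 then ((Skip, c, insert k S, k), b, Move_Left, Stay)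
      else ((Compare, c, S, k), b, Move_Right, Move_Right))"
| "census K N D (Skip, c, S, k) a b =
     (if b = 3 then (Rewind, c, S, k) else (Skip, c, S, k), b, Stay, Move_Right)"
| "census K N D (Rewind, c, S, k) a b =
     (if a = 0 \<or> a = 3 then ((Compare, c, S, k), b, Move_Right, Stay)
      else ((Rewind, c, S, k), b, Move_Left, Stay))"
| "census K N D (Advance, c, S, k) a b =
     (if a = 3 then (Restart, c, S, k) else (Advance, c, S, k), b, Move_Right, Stay)"
| "census K N D (Restart, c, S, k) a b =
     (if b = 0 then ((Compare, c, S, k), b, Stay, Move_Right)
      else ((Restart, c, S, k), b, Stay, Move_Left))"
| "census K N D (Accept, c, S, k) a b = ((Accept, c, S, k), b, Stay, Stay)"
| "census K N D (Reject, c, S, k) a b = ((Reject, c, S, k), b, Stay, Stay)"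

text \<open>Fixing \<open>c\<close> to be 0 off \<open>Pow {..K}\<close> leaves only finitely many
  functions.\<close>

definition census_states :: "nat \<Rightarrow> nat \<Rightarrow> state set" where
  "census_states K N =
     UNIV \<times> {c. \<forall>T. (T \<in> Pow {..K} \<longrightarrow> c T \<in> {..N}) \<and> (T \<notin> Pow {..K} \<longrightarrow> c T = 0)}
       \<times> Pow {..K} \<times> {..K}"

lemma finite_census_states: "finite (census_states K N)"
proof -
  have "(UNIV :: mode set) =
      {Copy, Back, Compare, Skip, Rewind, Advance, Restart, Accept, Reject}"
    using mode.exhaust by blast
  then have "finite (UNIV :: mode set)"
    by (metis finite.emptyI finite_insert)
  then show ?thesis
    unfolding census_states_def
    by (intro finite_cartesian_product finite_set_of_finite_funs) auto
qed

lemma verdict_in_census_states: "verdict b \<in> census_states K N"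
  by (simp add: verdict_def census_states_def)

lemma census_closed:
  assumes "s \<in> census_states K N" "census K N D s a b = (s', x, d, e)"
  shows "s' \<in> census_states K N \<and> x \<in> {a, b}"
proof -
  obtain q c S k where s: "s = (q, c, S, k)"
    by (metis prod_cases4)
  have "bump N S c T \<le> N" if "T \<subseteq> {..K}" for T
    using assms(1) that by (auto simp: s census_states_def bump_def)
  moreover have "bump N S c T = 0" if "\<not> T \<subseteq> {..K}" for T
    using assms(1) that by (auto simp: s census_states_def bump_def)
  ultimately have "(q', bump N S c, {}, 0) \<in> census_states K N" for q'
    by (simp add: census_states_def)
  moreover have "(q', c, S, k) \<in> census_states K N" "(q', c, insert k S, k) \<in> census_states K N"
    "(q', c, S, min K (k + 1)) \<in> census_states K N" for q'
    using assms(1) by (auto simp: s census_states_def)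
  ultimately show ?thesis
    using assms(2) verdict_in_census_states
    by (cases q) (auto simp: s split: if_splits simp del: add_Suc_right)
qed

text \<open>Used with \<open>L = vs # es\<close>: index 0 is the vertex list itself and hyperedge
  \<open>j\<close> has index \<open>Suc j\<close>, in agreement with the list counter of the
  machine.\<close>

definition vertex_type :: "nat list list \<Rightarrow> nat \<Rightarrow> nat set" where
  "vertex_type L v = {l. l < length L \<and> v \<in> set (L ! l)}"

section \<open>Runs of the census machine\<close>

context
  fixes K N :: nat and D :: "(nat set \<Rightarrow> nat) \<Rightarrow> bool" and f
  defines "f \<equiv> two_tape_step (census K N D) {verdict True, verdict False}"
begin

text \<open>Except while copying, both tapes have the same contents \<open>W\<close>, and the symbol
  written is the one read, so the update vanishes.\<close>

lemma census_steps:
  shows Skip_end: "W j = 3 \<Longrightarrow>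
      f ((Skip, c, S, k), (W, i), (W, j)) = ((Rewind, c, S, k), (W, i), (W, j + 1))"
    and Skip_next: "W j \<noteq> 3 \<Longrightarrow>
      f ((Skip, c, S, k), (W, i), (W, j)) = ((Skip, c, S, k), (W, i), (W, j + 1))"
    and Rewind_end: "W i \<in> {0, 3} \<Longrightarrow>
      f ((Rewind, c, S, k), (W, i), (W, j)) = ((Compare, c, S, k), (W, i + 1), (W, j))"
    and Rewind_next: "W i \<notin> {0, 3} \<Longrightarrow>
      f ((Rewind, c, S, k), (W, i), (W, j)) = ((Rewind, c, S, k), (W, i - 1), (W, j))"
    and Compare_verdict: "W i = 4 \<Longrightarrow>
      f ((Compare, c, S, k), (W, i), (W, j)) = (verdict (D c), (W, i), (W, j))"
    and Compare_end: "W i \<noteq> 4 \<Longrightarrow> W j = 0 \<Longrightarrow>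
      f ((Compare, c, S, k), (W, i), (W, j)) = ((Advance, bump N S c, {}, 0), (W, i), (W, j - 1))"
    and Compare_list: "W i \<noteq> 4 \<Longrightarrow> W j = 4 \<Longrightarrow>
      f ((Compare, c, S, k), (W, i), (W, j)) = ((Compare, c, S, min K (k + 1)), (W, i), (W, j + 1))"
    and Compare_differ: "W i \<noteq> 4 \<Longrightarrow> W j \<notin> {0, 4} \<Longrightarrow> W i \<noteq> W j \<Longrightarrow>
      f ((Compare, c, S, k), (W, i), (W, j)) = ((Skip, c, S, k), (W, i - 1), (W, j))"
    and Compare_equal: "W i = 3 \<Longrightarrow> W j = 3 \<Longrightarrow>
      f ((Compare, c, S, k), (W, i), (W, j)) = ((Skip, c, insert k S, k), (W, i - 1), (W, j))"
    and Compare_next: "W j \<notin> {0, 3, 4} \<Longrightarrow> W i = W j \<Longrightarrow>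
      f ((Compare, c, S, k), (W, i), (W, j)) = ((Compare, c, S, k), (W, i + 1), (W, j + 1))"
    and Advance_end: "W i = 3 \<Longrightarrow>
      f ((Advance, c, S, k), (W, i), (W, j)) = ((Restart, c, S, k), (W, i + 1), (W, j))"
    and Advance_next: "W i \<noteq> 3 \<Longrightarrow>
      f ((Advance, c, S, k), (W, i), (W, j)) = ((Advance, c, S, k), (W, i + 1), (W, j))"
    and Restart_end: "W j = 0 \<Longrightarrow>
      f ((Restart, c, S, k), (W, i), (W, j)) = ((Compare, c, S, k), (W, i), (W, j + 1))"
    and Restart_next: "W j \<noteq> 0 \<Longrightarrow>
      f ((Restart, c, S, k), (W, i), (W, j)) = ((Restart, c, S, k), (W, i), (W, j - 1))"
    and Back_end: "W j = 0 \<Longrightarrow>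
      f ((Back, c, S, k), (W, i), (W, j)) = ((Compare, c, S, k), (W, i + 1), (W, j + 1))"
    and Back_next: "W j \<noteq> 0 \<Longrightarrow>
      f ((Back, c, S, k), (W, i), (W, j)) = ((Back, c, S, k), (W, i - 1), (W, j - 1))"
    and Copy_end: "W i = 0 \<Longrightarrow>
      f ((Copy, c, S, k), (W, i), (U, j)) = ((Back, c, S, k), (W, i - 1), (U, j - 1))"
    and Copy_next: "W i \<noteq> 0 \<Longrightarrow>
      f ((Copy, c, S, k), (W, i), (U, j)) = ((Copy, c, S, k), (W, i + 1), (U(j := W i), j + 1))"
  by (auto simp: f_def verdict_def fun_upd_idem)

lemmas run_one = reaches_one[where f = f] and run_step = reaches_step[where f = f]

lemma Skip_run:
  assumes "reads W j (ys @ [3])" "3 \<notin> set ys"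
  shows "reaches f (Suc (length ys)) ((Skip, c, S, k), (W, i), (W, j))
    ((Rewind, c, S, k), (W, i), (W, j + int (length ys) + 1))"
  using assms
proof (induction ys arbitrary: j)
  case Nil
  then show ?case
    using run_one[OF Skip_end] by simp
next
  case (Cons y ys)
  then have "W j \<noteq> 3" by auto
  from run_step[OF Skip_next[where W = W, OF this] Cons.IH] Cons.prems show ?case
    by (simp add: add_ac)
qed

lemma Rewind_run:
  assumes "\<And>p'. p' < p \<Longrightarrow> W (i + int p') \<notin> {0, 3}" "W (i - 1) \<in> {0, 3}"
  shows "reaches f (Suc p) ((Rewind, c, S, k), (W, i + int p - 1), (W, j))
    ((Compare, c, S, k), (W, i), (W, j))"
  using assms(1)
proof (induction p)
  case 0
  show ?case
    using run_one[OF Rewind_end[where W = W, OF assms(2)]] by simp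
next
  case (Suc p)
  then have "W (i + int p) \<notin> {0, 3}" by simp
  from run_step[OF Rewind_next[where W = W, OF this] Suc.IH] Suc.prems show ?case
    by simp
qed

text \<open>Here \<open>p\<close> is the length of the common prefix. The terminator 3 exposes a
  proper prefix as a mismatch. The first head leaves one cell to the left, so that after a full
  match \<open>Rewind\<close> does not stop at the terminator of its own name.\<close>

lemma Compare_Rewind_run:
  assumes "reads W i (xs @ [3])" "set xs \<subseteq> {1, 2}" "reads W j (ys @ [3])" "set ys \<subseteq> {1, 2}"
  shows "\<exists>p\<le>length xs. reaches f (Suc (Suc (length ys))) ((Compare, c, S, k), (W, i), (W, j))
    ((Rewind, c, if xs = ys then insert k S else S, k),
     (W, i + int p - 1), (W, j + int (length ys) + 1))"
  using assms
proof (induction xs arbitrary: ys i j)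
  case Nil
  have i: "W i = 3"
    using Nil.prems by simp
  have skip: "reaches f (Suc (length ys)) ((Skip, c, S', k), (W, i - 1), (W, j))
    ((Rewind, c, S', k), (W, i - 1), (W, j + int (length ys) + 1))" for S'
    using Nil.prems by (intro Skip_run) auto
  show ?case
  proof (cases ys)
    case Nil
    then have "W j = 3"
      using Nil.prems by simp
    from run_step[OF Compare_equal[where W = W, OF i this] skip] Nil show ?thesis
      by simp
  next
    case (Cons y ys')
    then have "W j \<notin> {0, 4}" "W i \<noteq> W j" "W i \<noteq> 4"
      using Nil.prems by auto
    from run_step[OF Compare_differ[where W = W, OF this(3,1,2)] skip] Cons show ?thesis
      by simp
  qed
next
  case (Cons x xs)
  show ?case
  proof (cases "\<exists>ys'. ys = x # ys'")
    case True
    then obtain ys' where ys: "ys = x # ys'" by blast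
    have "\<exists>p\<le>length xs. reaches f (Suc (Suc (length ys')))
        ((Compare, c, S, k), (W, i + 1), (W, j + 1))
        ((Rewind, c, if xs = ys' then insert k S else S, k),
         (W, i + 1 + int p - 1), (W, j + 1 + int (length ys') + 1))"
      using Cons.prems by (intro Cons.IH) (simp_all add: ys)
    then obtain p where p: "p \<le> length xs" and run: "reaches f (Suc (Suc (length ys')))
        ((Compare, c, S, k), (W, i + 1), (W, j + 1))
        ((Rewind, c, if xs = ys' then insert k S else S, k),
         (W, i + 1 + int p - 1), (W, j + 1 + int (length ys') + 1))"
      by blast
    have "W j \<notin> {0, 3, 4}" "W i = W j"
      using Cons.prems by (auto simp: ys)
    from run_step[OF Compare_next[where W = W, OF this] run] p show ?thesis
      by (intro exI[of _ "Suc p"]) (simp add: ys add_ac)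
  next
    case False
    have skip: "reaches f (Suc (length ys)) ((Skip, c, S, k), (W, i - 1), (W, j))
      ((Rewind, c, S, k), (W, i - 1), (W, j + int (length ys) + 1))"
      using Cons.prems by (intro Skip_run) auto
    have "W j \<notin> {0, 4}" "W i \<noteq> W j" "W i \<noteq> 4"
      using Cons.prems False by (cases ys; auto)+
    from run_step[OF Compare_differ[where W = W, OF this(3,1,2)] skip] False show ?thesis
      by (intro exI[of _ 0]) auto
  qed
qed

lemma Compare_run:
  assumes xs: "reads W i (xs @ [3])" "set xs \<subseteq> {1, 2}" and "W (i - 1) \<in> {0, 3}"
    and ys: "reads W j (ys @ [3])" "set ys \<subseteq> {1, 2}"
  shows "reaches f (length ys + length xs + 3) ((Compare, c, S, k), (W, i), (W, j))
    ((Compare, c, if xs = ys then insert k S else S, k), (W, i), (W, j + int (length ys) + 1))"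
proof -
  obtain p where p: "p \<le> length xs" and run: "reaches f (Suc (Suc (length ys)))
      ((Compare, c, S, k), (W, i), (W, j))
      ((Rewind, c, if xs = ys then insert k S else S, k),
       (W, i + int p - 1), (W, j + int (length ys) + 1))"
    using Compare_Rewind_run[OF xs ys] by blast
  have "W (i + int p') \<notin> {0, 3}" if "p' < p" for p'
  proof -
    have "W (i + int p') = xs ! p'"
      using xs(1) p that unfolding reads_append by (simp add: reads_iff_nth)
    moreover have "xs ! p' \<in> set xs"
      using p that by simp
    ultimately show ?thesis
      using xs(2) by auto
  qed
  then have "reaches f (Suc p)
      ((Rewind, c, if xs = ys then insert k S else S, k),
       (W, i + int p - 1), (W, j + int (length ys) + 1))
      ((Compare, c, if xs = ys then insert k S else S, k), (W, i), (W, j + int (length ys) + 1))"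
    using assms(3) by (rule Rewind_run)
  from reaches_trans[OF run this] show ?thesis
    by (rule reaches_mono) (use p in simp)
qed

lemma list_run:
  assumes x: "reads W i (binary x @ [3])" "W (i - 1) \<in> {0, 3}"
    and "reads W j (encode_vertices ys)"
  shows "reaches f ((length (binary x) + 3) * length (encode_vertices ys))
    ((Compare, c, S, k), (W, i), (W, j))
    ((Compare, c, if x \<in> set ys then insert k S else S, min K (k + 1)),
     (W, i), (W, j + int (length (encode_vertices ys))))"
  using assms(3)
proof (induction ys arbitrary: j S)
  case Nil
  obtain b bs where "binary x = b # bs"
    using binary_neq_Nil[of x] by (cases "binary x") auto
  then have "W i \<noteq> 4"
    using set_binary[of x] x(1) by auto
  moreover have "W j = 4"
    using Nil by (simp add: encode_vertices_def)
  ultimately have "reaches f (Suc 0) ((Compare, c, S, k), (W, i), (W, j))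
    ((Compare, c, S, min K (k + 1)), (W, i), (W, j + 1))"
    by (intro run_one[OF Compare_list])
  then show ?case
    by (auto simp: encode_vertices_def intro: reaches_mono)
next
  case (Cons y ys)
  let ?S = "if x = y then insert k S else S" and ?b = "binary y"
  have enc: "encode_vertices (y # ys) = (?b @ [3]) @ encode_vertices ys"
    by (simp add: encode_vertices_def)
  have r: "reads W j (?b @ [3])" "reads W (j + int (length ?b) + 1) (encode_vertices ys)"
    using Cons.prems unfolding enc reads_append by (simp_all add: add_ac)
  have 1: "reaches f (length ?b + length (binary x) + 3) ((Compare, c, S, k), (W, i), (W, j))
      ((Compare, c, ?S, k), (W, i), (W, j + int (length ?b) + 1))"
    using Compare_run[OF x(1) set_binary x(2) r(1) set_binary, of c S k]
    by (simp add: binary_eq_iff)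
  have S: "(if x \<in> set ys then insert k ?S else ?S) = (if x \<in> set (y # ys) then insert k S else S)"
    by auto
  have pos: "j + int (length ?b) + 1 + int (length (encode_vertices ys))
      = j + int (length (encode_vertices (y # ys)))"
    by (simp add: enc)
  have "reaches f (length ?b + length (binary x) + 3
        + (length (binary x) + 3) * length (encode_vertices ys))
      ((Compare, c, S, k), (W, i), (W, j))
      ((Compare, c, if x \<in> set (y # ys) then insert k S else S, min K (k + 1)),
       (W, i), (W, j + int (length (encode_vertices (y # ys)))))"
    using reaches_trans[OF 1 Cons.IH[OF r(2), of ?S]] by (simp only: S pos)
  \<comment> \<open>A name with its terminator fills \<open>length ?b + 1\<close> cells, and its
    comparison costs at most \<open>length (binary x) + 3\<close> steps per cell.\<close>
  then show ?case
    by (rule reaches_mono) (simp add: enc algebra_simps)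
qed

text \<open>The bound on \<open>k + length L\<close> ensures that the cap \<open>K\<close> on the
  list counter never takes effect. \<open>S\<close> collects the type relative to the remaining
  lists, shifted by \<open>k\<close>.\<close>

lemma lists_run:
  assumes x: "reads W i (binary x @ [3])" "W (i - 1) \<in> {0, 3}"
    and "reads W j (concat (map encode_vertices L))" "k + length L \<le> K"
  shows "reaches f ((length (binary x) + 3) * length (concat (map encode_vertices L)))
    ((Compare, c, S, k), (W, i), (W, j))
    ((Compare, c, S \<union> (\<lambda>l. k + l) ` vertex_type L x, k + length L),
     (W, i), (W, j + int (length (concat (map encode_vertices L)))))"
  using assms(3,4)
proof (induction L arbitrary: j S k)
  case Nil
  show ?case
    by (simp add: vertex_type_def reaches_refl)
next
  case (Cons ys L)
  let ?e = "encode_vertices ys" and ?r = "concat (map encode_vertices L)"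
  define S' where "S' = (if x \<in> set ys then insert k S else S)"
  have 1: "reaches f ((length (binary x) + 3) * length ?e)
      ((Compare, c, S, k), (W, i), (W, j)) ((Compare, c, S', Suc k), (W, i), (W, j + int (length ?e)))"
    using list_run[OF x, of j ys c S k] Cons.prems
    by (simp add: reads_append min_absorb2 S'_def)
  have 2: "reaches f ((length (binary x) + 3) * length ?r)
      ((Compare, c, S', Suc k), (W, i), (W, j + int (length ?e)))
      ((Compare, c, S' \<union> (\<lambda>l. Suc k + l) ` vertex_type L x, Suc k + length L),
       (W, i), (W, j + int (length ?e) + int (length ?r)))"
    using Cons.prems by (intro Cons.IH) (simp_all add: reads_append)
  have "vertex_type (ys # L) x = (if x \<in> set ys then {0} else {}) \<union> Suc ` vertex_type L x"
    by (auto simp: vertex_type_def less_Suc_eq_0_disj image_iff)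
  then have "S \<union> (\<lambda>l. k + l) ` vertex_type (ys # L) x = S' \<union> (\<lambda>l. Suc k + l) ` vertex_type L x"
    by (auto simp: image_image S'_def)
  with reaches_trans[OF 1 2] show ?case
    by (simp add: distrib_left add_ac)
qed

lemma Advance_run:
  assumes "reads W i (xs @ [3])" "3 \<notin> set xs"
  shows "reaches f (Suc (length xs)) ((Advance, c, S, k), (W, i), (W, j))
    ((Restart, c, S, k), (W, i + int (length xs) + 1), (W, j))"
  using assms
proof (induction xs arbitrary: i)
  case Nil
  then show ?case
    using run_one[OF Advance_end] by simp
next
  case (Cons x xs)
  then have "W i \<noteq> 3" by auto
  from run_step[OF Advance_next[where W = W, OF this] Cons.IH] Cons.prems show ?case
    by (simp add: add_ac)
qed

text \<open>The head starts on the last nonblank cell, since \<open>Compare_end\<close> has moved it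
  off the blank behind the word; on that blank, \<open>Restart\<close> would stop at once.\<close>

lemma Restart_run:
  assumes "\<And>p'. p' < p \<Longrightarrow> W (int p') \<noteq> 0" "W (- 1) = 0"
  shows "reaches f (Suc p) ((Restart, c, S, k), (W, i), (W, int p - 1))
    ((Compare, c, S, k), (W, i), (W, 0))"
  using assms(1)
proof (induction p)
  case 0
  show ?case
    using run_one[OF Restart_end[where W = W, OF assms(2)]] by simp
next
  case (Suc p)
  then have "W (int p) \<noteq> 0" by simp
  from run_step[OF Restart_next[where W = W, OF this] Suc.IH] Suc.prems show ?case
    by simp
qed

lemma Back_run:
  assumes "\<And>p'. p' < p \<Longrightarrow> W (int p') \<noteq> 0" "W (- 1) = 0"
  shows "reaches f (Suc p) ((Back, c, S, k), (W, int p - 1), (W, int p - 1))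
    ((Compare, c, S, k), (W, 0), (W, 0))"
  using assms(1)
proof (induction p)
  case 0
  show ?case
    using run_one[OF Back_end[where W = W and i = "- 1", OF assms(2)]] by simp
next
  case (Suc p)
  then have "W (int p) \<noteq> 0" by simp
  from run_step[OF Back_next[where W = W and i = "int p", OF this] Suc.IH] Suc.prems
  show ?case
    by simp
qed

text \<open>The second tape agrees with \<open>W\<close> left of the heads and is blank from there
  on. Once the input is exhausted, \<open>W\<close> is blank there too and the copy is
  complete.\<close>

lemma Copy_run:
  assumes "reads W i ws" "0 \<notin> set ws" "\<And>p. p \<ge> i + int (length ws) \<Longrightarrow> W p = 0"
  shows "reaches f (Suc (length ws))
    ((Copy, c, S, k), (W, i), (\<lambda>p. if p < i then W p else 0, i))
    ((Back, c, S, k), (W, i + int (length ws) - 1), (W, i + int (length ws) - 1))"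
  using assms
proof (induction ws arbitrary: i)
  case Nil
  then have "(\<lambda>p. if p < i then W p else 0) = W" "W i = 0"
    by auto
  then show ?case
    using run_one[OF Copy_end] by simp
next
  case (Cons y ws)
  then have nz: "W i \<noteq> 0" by auto
  have upd: "(\<lambda>p. if p < i then W p else 0)(i := W i) = (\<lambda>p. if p < i + 1 then W p else 0)"
    by auto
  have "f ((Copy, c, S, k), (W, i), (\<lambda>p. if p < i then W p else 0, i)) =
      ((Copy, c, S, k), (W, i + 1), (\<lambda>p. if p < i + 1 then W p else 0, i + 1))"
    by (subst Copy_next[where W = W, OF nz]) (simp only: upd)
  from run_step[OF this Cons.IH] Cons.prems show ?case
    by (simp add: add_ac)
qed

section \<open>Time bounds for one vertex and for the whole computation\<close>

lemma round_run:
  assumes w: "w = concat (map encode_vertices L)" "reads W 0 w" "0 \<notin> set w"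
      "W (int (length w)) = 0" "W (- 1) = 0"
    and x: "reads W i (binary x @ [3])" "W (i - 1) \<in> {0, 3}" "length (binary x) \<le> length w"
    and L: "length L \<le> K"
  shows "reaches f ((length w + 3)\<^sup>2) ((Compare, c, {}, 0), (W, i), (W, 0))
    ((Compare, bump N (vertex_type L x) c, {}, 0),
     (W, i + int (length (binary x)) + 1), (W, 0))"
proof -
  let ?n = "length w" and ?b = "binary x" and ?T = "vertex_type L x"
  have 1: "reaches f ((length ?b + 3) * ?n) ((Compare, c, {}, 0), (W, i), (W, 0))
      ((Compare, c, ?T, length L), (W, i), (W, int ?n))"
    using lists_run[OF x(1,2), of 0 L 0 c "{}"] w L by simp
  obtain b bs where "?b = b # bs"
    using binary_neq_Nil[of x] by (cases ?b) auto
  then have "W i \<noteq> 4"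
    using set_binary[of x] x(1) by auto
  then have 2: "reaches f (Suc 0) ((Compare, c, ?T, length L), (W, i), (W, int ?n))
      ((Advance, bump N ?T c, {}, 0), (W, i), (W, int ?n - 1))"
    using w(4) by (intro run_one[OF Compare_end])
  have 3: "reaches f (Suc (length ?b)) ((Advance, bump N ?T c, {}, 0), (W, i), (W, int ?n - 1))
      ((Restart, bump N ?T c, {}, 0), (W, i + int (length ?b) + 1), (W, int ?n - 1))"
    using set_binary[of x] by (intro Advance_run x(1)) auto
  have "W (int p') \<noteq> 0" if "p' < ?n" for p'
    using w(2,3) that by (rule reads_nonzero)
  then have 4: "reaches f (Suc ?n)
      ((Restart, bump N ?T c, {}, 0), (W, i + int (length ?b) + 1), (W, int ?n - 1))
      ((Compare, bump N ?T c, {}, 0), (W, i + int (length ?b) + 1), (W, 0))"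
    using w(5) by (rule Restart_run)
  \<comment> \<open>Replacing the inequality by a sum makes the time bound a comparison of
    polynomials in \<open>length ?b\<close> and \<open>d\<close>.\<close>
  obtain d where d: "?n = length ?b + d"
    using x(3) le_Suc_ex by blast
  have "(length ?b + 3) * ?n + Suc 0 + Suc (length ?b) + Suc ?n \<le> (?n + 3)\<^sup>2"
    by (simp add: d power2_eq_square algebra_simps)
  with reaches_trans[OF reaches_trans[OF reaches_trans[OF 1 2] 3] 4] show ?thesis
    by (rule reaches_mono)
qed

text \<open>Here \<open>vs\<close> is the part of the vertex list still to be treated, while
  \<open>L\<close> and \<open>w\<close> stay fixed. The cell before a name is blank at the left end
  of the word and holds 3 otherwise. The final \<open>+ 1\<close> pays for the verdict.\<close>

lemma vertices_run:
  assumes w: "w = concat (map encode_vertices L)" "reads W 0 w" "0 \<notin> set w"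
      "W (int (length w)) = 0" "W (- 1) = 0"
    and L: "length L \<le> K"
    and "reads W i (encode_vertices vs)" "W (i - 1) \<in> {0, 3}"
    and "\<forall>v\<in>set vs. length (binary v) \<le> length w"
  shows "\<exists>cfg. reaches f ((length w + 3)\<^sup>2 * length vs + 1) ((Compare, c, {}, 0), (W, i), (W, 0)) cfg
    \<and> fst cfg = verdict (D (fold (bump N) (map (vertex_type L) vs) c))"
  using assms(7-)
proof (induction vs arbitrary: i c)
  case Nil
  then have "W i = 4"
    by (simp add: encode_vertices_def)
  from run_one[OF Compare_verdict[where W = W, OF this]] show ?case
    by (intro exI[of _ "(verdict (D c), (W, i), (W, 0))"]) simp
next
  case (Cons v vs)
  let ?b = "binary v" and ?c = "bump N (vertex_type L v) c"
  have "encode_vertices (v # vs) = (?b @ [3]) @ encode_vertices vs"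
    by (simp add: encode_vertices_def)
  then have r: "reads W i (?b @ [3])" "reads W (i + int (length ?b) + 1) (encode_vertices vs)"
    "W (i + int (length ?b) + 1 - 1) = 3"
    using Cons.prems(1) by (simp_all add: reads_append add_ac)
  have 1: "reaches f ((length w + 3)\<^sup>2) ((Compare, c, {}, 0), (W, i), (W, 0))
      ((Compare, ?c, {}, 0), (W, i + int (length ?b) + 1), (W, 0))"
    using Cons.prems by (intro round_run[OF w r(1) _ _ L]) auto
  obtain cfg where 2: "reaches f ((length w + 3)\<^sup>2 * length vs + 1)
      ((Compare, ?c, {}, 0), (W, i + int (length ?b) + 1), (W, 0)) cfg"
    and "fst cfg = verdict (D (fold (bump N) (map (vertex_type L) vs) ?c))"
    using Cons.IH[OF r(2), of ?c] r(3) Cons.prems(3) by auto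
  then show ?case
    using reaches_mono[OF reaches_trans[OF 1 2]] by (intro exI[of _ cfg]) simp
qed

lemma census_run:
  assumes w: "w = concat (map encode_vertices (vs # es))" and K: "Suc (length es) \<le> K"
  shows "\<exists>cfg. reaches f ((length w + 3) ^ 3)
      ((Copy, \<lambda>_. 0, {}, 0), input_tape w, input_tape []) cfg
    \<and> fst cfg = verdict (D (fold (bump N) (map (vertex_type (vs # es)) vs) (\<lambda>_. 0)))"
proof -
  let ?n = "length w" and ?W = "fst (input_tape w)" and ?c = "\<lambda>_. 0 :: nat"
  have reads: "reads ?W 0 w"
    by (simp add: reads_iff_nth input_tape_def)
  have outside: "?W p = 0" if "p < 0 \<or> p \<ge> int ?n" for p
    using that by (auto simp: input_tape_def)
  have "0 \<notin> set (binary v)" for v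
    using set_binary[of v] by auto
  then have w0: "0 \<notin> set w"
    by (auto simp: w encode_vertices_def)
  have "?W (int p') \<noteq> 0" if "p' < ?n" for p'
    using reads w0 that by (rule reads_nonzero)
  then have rewind: "reaches f (Suc ?n) ((Back, ?c, {}, 0), (?W, int ?n - 1), (?W, int ?n - 1))
      ((Compare, ?c, {}, 0), (?W, 0), (?W, 0))"
    using outside by (intro Back_run) auto
  have "input_tape w = (?W, 0)" "input_tape [] = (\<lambda>p. if p < 0 then ?W p else 0, 0)"
    by (auto simp: input_tape_def)
  then have copy: "reaches f (Suc ?n) ((Copy, ?c, {}, 0), input_tape w, input_tape [])
      ((Back, ?c, {}, 0), (?W, int ?n - 1), (?W, int ?n - 1))"
    using Copy_run[OF reads w0, of ?c "{}" 0] outside by simp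
  have len: "length vs \<le> length (encode_vertices vs)" "length (encode_vertices vs) \<le> ?n"
    "\<forall>v\<in>set vs. length (binary v) \<le> length (encode_vertices vs)"
  proof -
    show "length vs \<le> length (encode_vertices vs)"
      by (induction vs) (auto simp: encode_vertices_def)
    show "length (encode_vertices vs) \<le> ?n"
      by (simp add: w)
    show "\<forall>v\<in>set vs. length (binary v) \<le> length (encode_vertices vs)"
      by (induction vs) (auto simp: encode_vertices_def)
  qed
  obtain cfg where main: "reaches f ((?n + 3)\<^sup>2 * length vs + 1)
      ((Compare, ?c, {}, 0), (?W, 0), (?W, 0)) cfg"
    and cfg: "fst cfg = verdict (D (fold (bump N) (map (vertex_type (vs # es)) vs) ?c))"
  proof -
    have "reads ?W 0 (encode_vertices vs)"
      using reads by (simp add: w reads_append)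
    moreover have "\<forall>v\<in>set vs. length (binary v) \<le> ?n"
      using len(2,3) order_trans by blast
    ultimately show thesis
      using vertices_run[OF w reads w0, of 0 vs ?c] K outside that by auto
  qed
  obtain d where d: "?n = length vs + d"
    using le_Suc_ex[OF order_trans[OF len(1,2)]] by blast
  \<comment> \<open>Copying and going back are linear, and there are at most \<open>?n\<close>
    rounds because each vertex name has its own terminator.\<close>
  have "Suc ?n + Suc ?n + ((?n + 3)\<^sup>2 * length vs + 1) \<le> (?n + 3) ^ 3"
    by (simp add: d power2_eq_square power3_eq_cube algebra_simps)
  with reaches_trans[OF reaches_trans[OF copy rewind] main] have
    "reaches f ((?n + 3) ^ 3) ((Copy, ?c, {}, 0), input_tape w, input_tape []) cfg"
    by (rule reaches_mono)
  with cfg show ?thesis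
    by blast
qed

end

text \<open>Truncating after every increment gives the same result as truncating the final
  count.\<close>

lemma fold_bump:
  assumes "\<And>T. c T \<le> N"
  shows "fold (bump N) Ts c T = min N (c T + count_list Ts T)"
  using assms
proof (induction Ts arbitrary: c)
  case (Cons S Ts)
  have "bump N S c T' \<le> N" for T'
    using Cons.prems by (simp add: bump_def)
  from Cons.IH[OF this] show ?case
    by (auto simp: bump_def)
qed (simp add: min_absorb2)

section \<open>The decision procedure\<close>

lemma count_list_map_eq_type_count:
  assumes "distinct vs"
  shows "count_list (map \<tau> vs) T = type_count (set vs) \<tau> T"
proof -
  have "count_list (map \<tau> vs) T = length (filter (\<lambda>v. \<tau> v = T) vs)"
    by (induction vs) auto
  also have "\<dots> = card (set (filter (\<lambda>v. \<tau> v = T) vs))"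
    by (rule distinct_card[symmetric]) (simp add: assms)
  finally show ?thesis
    by (simp add: type_count_def)
qed

text \<open>Since hyperedges lie inside \<open>hverts H\<close>, the vertices whose type contains
  \<open>Suc j\<close> are exactly those of the \<open>j\<close>-th hyperedge.\<close>

lemma has_support_satisfying_iff_typed_support:
  assumes "wf_hypergraph H" "set vs = hverts H" "set (map set es) = hedges H"
  shows "has_support_satisfying P H \<longleftrightarrow>
    typed_support P (Suc ` {..<length es}) (hverts H) (vertex_type (vs # es))"
proof -
  have edge: "{v \<in> hverts H. Suc j \<in> vertex_type (vs # es) v} = set (es ! j)" if "j < length es" for j
  proof -
    have "set (es ! j) \<in> hedges H"
      unfolding assms(3)[symmetric] using that by simp
    then show ?thesis
      using that assms(1) by (auto simp: vertex_type_def wf_hypergraph_def)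
  qed
  have "hedges H = (\<lambda>j. set (es ! j)) ` {..<length es}"
    unfolding assms(3)[symmetric] by (force simp: in_set_conv_nth)
  then have "support H G \<longleftrightarrow> pair_graph G \<and> pverts G = hverts H \<and>
      (\<forall>j\<in>Suc ` {..<length es}. spans (parcs G) {v \<in> hverts H. j \<in> vertex_type (vs # es) v})" for G
    using edge by (auto simp: support_def connected_induce_iff)
  then show ?thesis
    by (auto simp: has_support_satisfying_def typed_support_def)
qed

theorem theorem3:
  fixes P :: "ngraph \<Rightarrow> bool"
  assumes "graph_property P"
    and "closed_under_adding_leaves P"
  shows "\<exists>(f :: nat \<Rightarrow> nat) (p :: nat poly). \<forall>m. \<exists>M. turing_machine M \<and>
           (\<forall>H w. wf_hypergraph H \<and> card (hedges H) = m \<and> encodes w H \<longrightarrow>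
              answers_within M w (has_support_satisfying P H) (f m * poly p (length w)))"
\<comment> \<open>The polynomial is the cube of \<open>x + 3\<close> from \<open>census_run\<close>.
  The factor depending on \<open>m\<close> can be 1, because that dependence sits in the choice of
  the machine.\<close>
proof (intro exI[of _ "\<lambda>_. 1"] exI[of _ "[:3, 1:] ^ 3"] allI)
  fix m :: nat
  let ?J = "Suc ` {..<m}"
  obtain N where N: "\<And>V V' \<tau> \<tau>'.
    \<lbrakk>finite V; finite V'; \<tau> ` V \<subseteq> Pow {..m}; \<tau>' ` V' \<subseteq> Pow {..m};
     \<And>T. min N (type_count V \<tau> T) = min N (type_count V' \<tau>' T); typed_support P ?J V \<tau>\<rbrakk>
    \<Longrightarrow> typed_support P ?J V' \<tau>'"
    using typed_support_threshold[OF assms, of "{..m}" ?J] by blast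
  \<comment> \<open>The hardwired table: some supported instance truncates to \<open>c\<close>. By
    the choice of \<open>N\<close>, then every instance truncating to \<open>c\<close> has a
    support.\<close>
  define D where "D c \<longleftrightarrow> (\<exists>V \<tau>. finite V \<and> \<tau> ` V \<subseteq> Pow {..m} \<and> typed_support P ?J V \<tau> \<and>
    c = (\<lambda>T. min N (type_count V \<tau> T)))" for c
  \<comment> \<open>The list counter is capped at \<open>Suc m\<close>, the number of lists in the
    input: \<open>m\<close> hyperedges and the vertex list.\<close>
  have start: "(Copy, \<lambda>_. 0, {}, 0) \<in> census_states (Suc m) N"
    by (simp add: census_states_def)
  have neq: "verdict True \<noteq> verdict False"
    by (simp add: verdict_def)
  obtain M where M: "turing_machine M" and run: "\<And>w b t cfg.
      reaches (two_tape_step (census (Suc m) N D) {verdict True, verdict False}) t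
        ((Copy, \<lambda>_. 0, {}, 0), input_tape w, input_tape []) cfg \<Longrightarrow>
      fst cfg = (if b then verdict True else verdict False) \<Longrightarrow> answers_within M w b t"
    by (rule two_tape_machine[where \<delta> = "census (Suc m) N D",
          OF finite_census_states start verdict_in_census_states verdict_in_census_states neq
            census_closed]) blast+
  have "answers_within M w (has_support_satisfying P H) ((length w + 3) ^ 3)"
    if H: "wf_hypergraph H" "card (hedges H) = m" "encodes w H" for H w
  proof -
    obtain vs es where vs: "distinct vs" "set vs = hverts H"
      and es: "distinct (map set es)" "set (map set es) = hedges H"
      and w: "w = concat (map encode_vertices (vs # es))"
      using H(3) unfolding encodes_def by blast
    have m: "length es = m"
      using distinct_card[OF es(1)] es(2) H(2) by simp
    let ?V = "hverts H" and ?\<tau> = "vertex_type (vs # es)"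
    have V: "finite ?V" "?\<tau> ` ?V \<subseteq> Pow {..m}"
      using H(1) by (auto simp: wf_hypergraph_def vertex_type_def m)
    have "fold (bump N) (map ?\<tau> vs) (\<lambda>_. 0) = (\<lambda>T. min N (type_count ?V ?\<tau> T))"
      using vs by (simp add: fun_eq_iff fold_bump count_list_map_eq_type_count)
    moreover have "D (\<lambda>T. min N (type_count ?V ?\<tau> T)) \<longleftrightarrow> typed_support P ?J ?V ?\<tau>"
    proof
      assume "D (\<lambda>T. min N (type_count ?V ?\<tau> T))"
      then obtain U \<sigma> where U: "finite U" "\<sigma> ` U \<subseteq> Pow {..m}" "typed_support P ?J U \<sigma>"
        and eq: "(\<lambda>T. min N (type_count ?V ?\<tau> T)) = (\<lambda>T. min N (type_count U \<sigma> T))"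
        unfolding D_def by blast
      from fun_cong[OF eq] have "min N (type_count U \<sigma> T) = min N (type_count ?V ?\<tau> T)" for T
        by simp
      then show "typed_support P ?J ?V ?\<tau>"
        by (rule N[OF U(1) V(1) U(2) V(2) _ U(3)])
    next
      assume "typed_support P ?J ?V ?\<tau>"
      with V show "D (\<lambda>T. min N (type_count ?V ?\<tau> T))"
        unfolding D_def by blast
    qed
    ultimately have "D (fold (bump N) (map ?\<tau> vs) (\<lambda>_. 0)) \<longleftrightarrow> has_support_satisfying P H"
      using has_support_satisfying_iff_typed_support[OF H(1) vs(2) es(2)] by (simp add: m)
    with census_run[OF w, of "Suc m" N D] m obtain cfg where
      "reaches (two_tape_step (census (Suc m) N D) {verdict True, verdict False})
        ((length w + 3) ^ 3) ((Copy, \<lambda>_. 0, {}, 0), input_tape w, input_tape []) cfg"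
      "fst cfg = verdict (has_support_satisfying P H)"
      by auto
    then show ?thesis
      by (intro run) auto
  qed
  with M show "\<exists>M. turing_machine M \<and>
      (\<forall>H w. wf_hypergraph H \<and> card (hedges H) = m \<and> encodes w H \<longrightarrow>
        answers_within M w (has_support_satisfying P H) (1 * poly ([:3, 1:] ^ 3) (length w)))"
    by (intro exI[of _ M]) (auto simp: add.commute)
qed

end
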